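(* Let $\mathcal T_1,\mathcal T,\mathcal T_2$ be monoids. Given $(\mathcal T_1,\mathcal T)$-bimodules $M_1,N_1$ and $(\mathcal T,\mathcal T_2)$-bimodules $M_2,N_2$ (with null parts ${M_i}_0$, ${N_i}_0$), suppose $f_1:M_1\to N_1$ is a $(\mathcal T_1,\mathcal T)$-bimodule homomorphism and $f_2:M_2\to N_2$ is a $(\mathcal T,\mathcal T_2)$-bimodule homomorphism. Then there is a $(\mathcal T_1,\mathcal T_2)$-bimodule homomorphism $$f_1\otimes f_2: M_1\otimes_{\mathcal T}M_2\to N_1\otimes_{\mathcal T}N_2$$ given by $(f_1\otimes f_2)(v_1\otimes v_2)=f_1(v_1)\otimes f_2(v_2)$, which sends $(M_1\otimes_{\mathcal T} M_2)_0$ to $(N_1\otimes_{\mathcal T} N_2)_0$.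
   Context: All monoids are multiplicative with unit $\mathbb 1$, not necessarily commutative. For monoids $\mathcal T_1,\mathcal T_2$, a $(\mathcal T_1,\mathcal T_2)$-bimodule is a commutative monoid $(M,+,0)$ with a left action of $\mathcal T_1$ and a right action of $\mathcal T_2$ that are unital, associative ($a(a'b)=(aa')b$, and likewise on the right), distributive over $+$, fix $0$, and satisfy $(a_1b)a_2=a_1(ba_2)$. No negation is assumed. A homomorphism of bimodules is a map preserving $0$, $+$ and both actions. The null part of a bimodule $M$ is a chosen sub-bimodule $M_0$ (a submonoid of $(M,+,0)$ closed under both actions); the couple $(M,M_0)$ is called a bimodule prepair. For a right $\mathcal T$-module $M_1$ and a left $\mathcal T$-module $M_2$, $M_1\otimes_{\mathcal T}M_2$ is the quotient of the free commutative monoid (formal finite sums) on the set $M_1\times M_2$ by the congruence generated by $(v_1+w_1,x_2)\sim(v_1,x_2)+(w_1,x_2)$, $(x_1,v_2+w_2)\sim(x_1,v_2)+(x_1,w_2)$, $(x_1a,x_2)\sim(x_1,ax_2)$, and $(0,x_2)\sim 0\sim(x_1,0)$, for all $x_i,v_i,w_i\in M_i$, $a\in\mathcal T$. The class of $(v_1,v_2)$ is written $v_1\otimes v_2$ (a simple tensor). If $M_1$ is a $(\mathcal T_1,\mathcal T)$-bimodule and $M_2$ a $(\mathcal T,\mathcal T_2)$-bimodule, the $(\mathcal T_1,\mathcal T_2)$-bimodule structure on $M_1\otimes_{\mathcal T}M_2$ is determined by $a_1(v_1\otimes v_2)=(a_1v_1)\otimes v_2$ and $(v_1\otimes v_2)a_2=v_1\otimes(v_2a_2)$.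 The null part of the tensor product is $(M_1\otimes_{\mathcal T} M_2)_0:=({M_1}_0\otimes_{\mathcal T}M_2)+(M_1\otimes_{\mathcal T}{M_2}_0)$, meaning the set of all finite sums in $M_1\otimes_{\mathcal T} M_2$ of simple tensors $v_1\otimes v_2$ with $v_1\in {M_1}_0$ or $v_2\in {M_2}_0$.
   Formalization: The claim that f1⊗f2 sends (M1⊗M2)_0 to (N1⊗N2)_0 is proved only when f1 and f2 send the null parts of M1, M2 into those of N1, N2; without this it fails (e.g. identity maps on the naturals with (M1)_0=M1 and all other null parts zero). *)

theory Defs
  imports "HOL-Library.Multiset" "HOL-Algebra.Ring"
begin

section \<open>Bimodules over monoids\<close>

text \<open>As for modules in HOL-Algebra, the additive structure is carried by the fields
  \<open>carrier\<close>, \<open>zero\<close> and \<open>add\<close> of the ring record; its multiplicative fields are not used.\<close>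

record ('a, 'm, 'b) bimodule = "'m ring" +
  lact :: "'a \<Rightarrow> 'm \<Rightarrow> 'm" (infixr \<open>\<triangleright>\<index>\<close> 70)
  ract :: "'m \<Rightarrow> 'b \<Rightarrow> 'm" (infixl \<open>\<triangleleft>\<index>\<close> 70)

locale bimodule = A: monoid A + B: monoid B + M?: abelian_monoid M
  for A :: "('a, 'r) monoid_scheme" and B :: "('b, 's) monoid_scheme"
    and M :: "('a, 'm, 'b, 'z) bimodule_scheme" (structure) +
  assumes lact_closed: "\<lbrakk>a \<in> carrier A; x \<in> carrier M\<rbrakk> \<Longrightarrow> a \<triangleright> x \<in> carrier M"
    and ract_closed: "\<lbrakk>x \<in> carrier M; b \<in> carrier B\<rbrakk> \<Longrightarrow> x \<triangleleft> b \<in> carrier M"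
    and lact_one: "x \<in> carrier M \<Longrightarrow> \<one>\<^bsub>A\<^esub> \<triangleright> x = x"
    and ract_one: "x \<in> carrier M \<Longrightarrow> x \<triangleleft> \<one>\<^bsub>B\<^esub> = x"
    and lact_assoc: "\<lbrakk>a \<in> carrier A; a' \<in> carrier A; x \<in> carrier M\<rbrakk>
      \<Longrightarrow> a \<triangleright> (a' \<triangleright> x) = (a \<otimes>\<^bsub>A\<^esub> a') \<triangleright> x"
    and ract_assoc: "\<lbrakk>x \<in> carrier M; b \<in> carrier B; b' \<in> carrier B\<rbrakk>
      \<Longrightarrow> (x \<triangleleft> b) \<triangleleft> b' = x \<triangleleft> (b \<otimes>\<^bsub>B\<^esub> b')"
    and lact_add: "\<lbrakk>a \<in> carrier A; x \<in> carrier M; y \<in> carrier M\<rbrakk>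
      \<Longrightarrow> a \<triangleright> (x \<oplus> y) = (a \<triangleright> x) \<oplus> (a \<triangleright> y)"
    and ract_add: "\<lbrakk>x \<in> carrier M; y \<in> carrier M; b \<in> carrier B\<rbrakk>
      \<Longrightarrow> (x \<oplus> y) \<triangleleft> b = (x \<triangleleft> b) \<oplus> (y \<triangleleft> b)"
    and lact_zero: "a \<in> carrier A \<Longrightarrow> a \<triangleright> \<zero> = \<zero>"
    and ract_zero: "b \<in> carrier B \<Longrightarrow> \<zero> \<triangleleft> b = \<zero>"
    and act_assoc: "\<lbrakk>a \<in> carrier A; x \<in> carrier M; b \<in> carrier B\<rbrakk>
      \<Longrightarrow> (a \<triangleright> x) \<triangleleft> b = a \<triangleright> (x \<triangleleft> b)"

locale bimodule_hom = M: bimodule A B M + N: bimodule A B N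
  for A :: "('a, 'r) monoid_scheme" and B :: "('b, 's) monoid_scheme"
    and M :: "('a, 'm, 'b, 'z) bimodule_scheme"
    and N :: "('a, 'n, 'b, 'y) bimodule_scheme"
    and f :: "'m \<Rightarrow> 'n" +
  assumes hom_closed: "f \<in> carrier M \<rightarrow> carrier N"
    and hom_zero: "f \<zero>\<^bsub>M\<^esub> = \<zero>\<^bsub>N\<^esub>"
    and hom_add: "\<lbrakk>x \<in> carrier M; y \<in> carrier M\<rbrakk> \<Longrightarrow> f (x \<oplus>\<^bsub>M\<^esub> y) = f x \<oplus>\<^bsub>N\<^esub> f y"
    and hom_lact: "\<lbrakk>a \<in> carrier A; x \<in> carrier M\<rbrakk> \<Longrightarrow> f (a \<triangleright>\<^bsub>M\<^esub> x) = a \<triangleright>\<^bsub>N\<^esub> f x"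
    and hom_ract: "\<lbrakk>x \<in> carrier M; b \<in> carrier B\<rbrakk> \<Longrightarrow> f (x \<triangleleft>\<^bsub>M\<^esub> b) = f x \<triangleleft>\<^bsub>N\<^esub> b"

locale bimodule_prepair = bimodule A B M + null: submonoid M0 "add_monoid M"
  for A :: "('a, 'r) monoid_scheme" and B :: "('b, 's) monoid_scheme"
    and M :: "('a, 'm, 'b, 'z) bimodule_scheme" (structure) and M0 :: "'m set" +
  assumes null_lact: "\<lbrakk>a \<in> carrier A; x \<in> M0\<rbrakk> \<Longrightarrow> a \<triangleright> x \<in> M0"
    and null_ract: "\<lbrakk>x \<in> M0; b \<in> carrier B\<rbrakk> \<Longrightarrow> x \<triangleleft> b \<in> M0"

section \<open>Tensor products\<close>

text \<open>The free commutative monoid on \<open>carrier M1 \<times> carrier M2\<close> consists of the finite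
  multisets over that set.\<close>

definition formal_sums ::
  "('a, 'm, 't, 'y) bimodule_scheme \<Rightarrow> ('t, 'n, 'b, 'z) bimodule_scheme \<Rightarrow> ('m \<times> 'n) multiset set"
  where "formal_sums M1 M2 = {p. set_mset p \<subseteq> carrier M1 \<times> carrier M2}"

inductive tensor_cong ::
  "('t, 'r) monoid_scheme \<Rightarrow> ('a, 'm, 't, 'y) bimodule_scheme \<Rightarrow> ('t, 'n, 'b, 'z) bimodule_scheme
    \<Rightarrow> ('m \<times> 'n) multiset \<Rightarrow> ('m \<times> 'n) multiset \<Rightarrow> bool"
  for T M1 M2 where
  add_left: "\<lbrakk>v \<in> carrier M1; w \<in> carrier M1; x \<in> carrier M2\<rbrakk>
    \<Longrightarrow> tensor_cong T M1 M2 {#(v \<oplus>\<^bsub>M1\<^esub> w, x)#} {#(v, x), (w, x)#}"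
| add_right: "\<lbrakk>x \<in> carrier M1; v \<in> carrier M2; w \<in> carrier M2\<rbrakk>
    \<Longrightarrow> tensor_cong T M1 M2 {#(x, v \<oplus>\<^bsub>M2\<^esub> w)#} {#(x, v), (x, w)#}"
| balanced: "\<lbrakk>x \<in> carrier M1; a \<in> carrier T; y \<in> carrier M2\<rbrakk>
    \<Longrightarrow> tensor_cong T M1 M2 {#(x \<triangleleft>\<^bsub>M1\<^esub> a, y)#} {#(x, a \<triangleright>\<^bsub>M2\<^esub> y)#}"
| zero_left: "x \<in> carrier M2 \<Longrightarrow> tensor_cong T M1 M2 {#(\<zero>\<^bsub>M1\<^esub>, x)#} {#}"
| zero_right: "x \<in> carrier M1 \<Longrightarrow> tensor_cong T M1 M2 {#(x, \<zero>\<^bsub>M2\<^esub>)#} {#}"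
| refl: "p \<in> formal_sums M1 M2 \<Longrightarrow> tensor_cong T M1 M2 p p"
| sym: "tensor_cong T M1 M2 p q \<Longrightarrow> tensor_cong T M1 M2 q p"
| trans: "\<lbrakk>tensor_cong T M1 M2 p q; tensor_cong T M1 M2 q r\<rbrakk> \<Longrightarrow> tensor_cong T M1 M2 p r"
| add: "\<lbrakk>tensor_cong T M1 M2 p q; tensor_cong T M1 M2 p' q'\<rbrakk>
    \<Longrightarrow> tensor_cong T M1 M2 (p + p') (q + q')"

definition tensor_class ::
  "('t, 'r) monoid_scheme \<Rightarrow> ('a, 'm, 't, 'y) bimodule_scheme \<Rightarrow> ('t, 'n, 'b, 'z) bimodule_scheme
    \<Rightarrow> ('m \<times> 'n) multiset \<Rightarrow> ('m \<times> 'n) multiset set"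
  where "tensor_class T M1 M2 p = {q. tensor_cong T M1 M2 p q}"

definition simple_tensor ::
  "('t, 'r) monoid_scheme \<Rightarrow> ('a, 'm, 't, 'y) bimodule_scheme \<Rightarrow> ('t, 'n, 'b, 'z) bimodule_scheme
    \<Rightarrow> 'm \<Rightarrow> 'n \<Rightarrow> ('m \<times> 'n) multiset set"
  where "simple_tensor T M1 M2 v w = tensor_class T M1 M2 {#(v, w)#}"

text \<open>The operations are computed on representatives: each union is over sets that all coincide
  when its arguments are congruence classes and scalars lie in the acting monoid.\<close>

definition tensor ::
  "('t, 'r) monoid_scheme \<Rightarrow> ('a, 'm, 't, 'y) bimodule_scheme \<Rightarrow> ('t, 'n, 'b, 'z) bimodule_scheme
    \<Rightarrow> ('a, ('m \<times> 'n) multiset set, 'b) bimodule"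
  where "tensor T M1 M2 =
    \<lparr> carrier = tensor_class T M1 M2 ` formal_sums M1 M2,
      mult = undefined, one = undefined,
      zero = tensor_class T M1 M2 {#},
      add = (\<lambda>X Y. \<Union>p\<in>X. \<Union>q\<in>Y. tensor_class T M1 M2 (p + q)),
      lact = (\<lambda>a X. \<Union>p\<in>X. tensor_class T M1 M2 {#(a \<triangleright>\<^bsub>M1\<^esub> v, w). (v, w) \<in># p#}),
      ract = (\<lambda>X b. \<Union>p\<in>X. tensor_class T M1 M2 {#(v, w \<triangleleft>\<^bsub>M2\<^esub> b). (v, w) \<in># p#}) \<rparr>"

definition tensor_null ::
  "('t, 'r) monoid_scheme \<Rightarrow> ('a, 'm, 't, 'y) bimodule_scheme \<Rightarrow> 'm set
    \<Rightarrow> ('t, 'n, 'b, 'z) bimodule_scheme \<Rightarrow> 'n set \<Rightarrow> ('m \<times> 'n) multiset set set"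
  where "tensor_null T M1 M10 M2 M20 =
    {\<Oplus>\<^bsub>tensor T M1 M2\<^esub>i\<in>{..<k}. simple_tensor T M1 M2 (v i) (w i) | (k::nat) v w.
       \<forall>i<k. v i \<in> carrier M1 \<and> w i \<in> carrier M2 \<and> (v i \<in> M10 \<or> w i \<in> M20)}"

end

theory Submission
  imports Defs
begin

text \<open>The relations generating the tensor congruence are preserved by any pair of additive,
  \<open>T\<close>-linear maps applied entrywise to formal sums. The actions on a tensor product and the map
  \<open>f1 \<otimes> f2\<close> are all instances of this single construction.\<close>

lemma tensor_class_eqI: "tensor_cong T M1 M2 p q \<Longrightarrow> tensor_class T M1 M2 p = tensor_class T M1 M2 q"
  unfolding tensor_class_def using tensor_cong.sym tensor_cong.trans by blast

text \<open>Collapses the unions over representatives by which the operations of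
  \<open>tensor\<close> are defined. The sets in the union coincide because \<open>h\<close>
  respects the congruence, and reflexivity at \<open>p\<close> ensures that the index set is not
  empty.\<close>

lemma tensor_class_Union:
  assumes "p \<in> formal_sums M1 M2"
    and "\<And>q. tensor_cong T M1 M2 p q \<Longrightarrow> tensor_cong T N1 N2 (h p) (h q)"
  shows "(\<Union>q\<in>tensor_class T M1 M2 p. tensor_class T N1 N2 (h q)) = tensor_class T N1 N2 (h p)"
proof -
  have "tensor_class T N1 N2 (h q) = tensor_class T N1 N2 (h p)" if "q \<in> tensor_class T M1 M2 p" for q
    using assms(2)[of q] that by (simp add: tensor_class_def[of T M1 M2] tensor_class_eqI)
  moreover have "p \<in> tensor_class T M1 M2 p"
    using assms(1) by (simp add: tensor_class_def tensor_cong.refl)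
  ultimately show ?thesis by blast
qed

lemma formal_sums_empty: "{#} \<in> formal_sums M1 M2"
  by (simp add: formal_sums_def)

lemma formal_sums_add:
  "\<lbrakk>p \<in> formal_sums M1 M2; q \<in> formal_sums M1 M2\<rbrakk> \<Longrightarrow> p + q \<in> formal_sums M1 M2"
  by (simp add: formal_sums_def)

lemma image_formal_sums:
  assumes "g1 \<in> carrier M1 \<rightarrow> carrier N1" and "g2 \<in> carrier M2 \<rightarrow> carrier N2"
    and "p \<in> formal_sums M1 M2"
  shows "{#(g1 v, g2 w). (v, w) \<in># p#} \<in> formal_sums N1 N2"
  using assms by (fastforce simp: formal_sums_def)

lemma (in bimodule) lact_formal_sums:
  assumes "a \<in> carrier A" and "p \<in> formal_sums M M2"
  shows "{#(a \<triangleright> v, w). (v, w) \<in># p#} \<in> formal_sums M M2"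
  using assms by (intro image_formal_sums) (auto simp: lact_closed)

lemma (in bimodule) ract_formal_sums:
  assumes "b \<in> carrier B" and "p \<in> formal_sums M1 M"
  shows "{#(v, w \<triangleleft> b). (v, w) \<in># p#} \<in> formal_sums M1 M"
  using assms by (intro image_formal_sums) (auto simp: ract_closed)

text \<open>By induction on the derivation: each generating relation goes to one of the same kind,
  and \<open>image_mset\<close> commutes with \<open>+\<close>. Linearity is asked only over the
  inner monoid \<open>T\<close>, so that \<open>g1\<close> or \<open>g2\<close> may also be the
  action of an outer scalar, which need not commute with the other outer scalars.\<close>

lemma tensor_cong_image:
  assumes g1: "g1 \<in> carrier M1 \<rightarrow> carrier N1"
    and g1_zero: "g1 \<zero>\<^bsub>M1\<^esub> = \<zero>\<^bsub>N1\<^esub>"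
    and g1_add: "\<And>x y. \<lbrakk>x \<in> carrier M1; y \<in> carrier M1\<rbrakk> \<Longrightarrow> g1 (x \<oplus>\<^bsub>M1\<^esub> y) = g1 x \<oplus>\<^bsub>N1\<^esub> g1 y"
    and g1_ract: "\<And>x t. \<lbrakk>x \<in> carrier M1; t \<in> carrier T\<rbrakk> \<Longrightarrow> g1 (x \<triangleleft>\<^bsub>M1\<^esub> t) = g1 x \<triangleleft>\<^bsub>N1\<^esub> t"
    and g2: "g2 \<in> carrier M2 \<rightarrow> carrier N2"
    and g2_zero: "g2 \<zero>\<^bsub>M2\<^esub> = \<zero>\<^bsub>N2\<^esub>"
    and g2_add: "\<And>x y. \<lbrakk>x \<in> carrier M2; y \<in> carrier M2\<rbrakk> \<Longrightarrow> g2 (x \<oplus>\<^bsub>M2\<^esub> y) = g2 x \<oplus>\<^bsub>N2\<^esub> g2 y"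
    and g2_lact: "\<And>x t. \<lbrakk>x \<in> carrier M2; t \<in> carrier T\<rbrakk> \<Longrightarrow> g2 (t \<triangleright>\<^bsub>M2\<^esub> x) = t \<triangleright>\<^bsub>N2\<^esub> g2 x"
    and pq: "tensor_cong T M1 M2 p q"
  shows "tensor_cong T N1 N2 {#(g1 v, g2 w). (v, w) \<in># p#} {#(g1 v, g2 w). (v, w) \<in># q#}"
  using pq
proof induction
  case (add_left v w x)
  then show ?case
    using g1 g2 by (auto simp: g1_add intro!: tensor_cong.add_left)
next
  case (add_right x v w)
  then show ?case
    using g1 g2 by (auto simp: g2_add intro!: tensor_cong.add_right)
next
  case (balanced x a y)
  then show ?case
    using g1 g2 by (auto simp: g1_ract g2_lact intro!: tensor_cong.balanced)
next
  case (zero_left x)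
  then show ?case
    using g2 by (auto simp: g1_zero intro!: tensor_cong.zero_left)
next
  case (zero_right x)
  then show ?case
    using g1 by (auto simp: g2_zero intro!: tensor_cong.zero_right)
next
  case (refl p)
  then show ?case
    using image_formal_sums[OF g1 g2] by (auto intro: tensor_cong.refl)
next
  case (sym p q)
  from sym.IH show ?case by (rule tensor_cong.sym)
next
  case (trans p q r)
  from trans.IH show ?case by (rule tensor_cong.trans)
next
  case (add p q p' q')
  then show ?case by (simp add: tensor_cong.add)
qed

lemma carrier_tensor: "carrier (tensor T M1 M2) = tensor_class T M1 M2 ` formal_sums M1 M2"
  and zero_tensor: "\<zero>\<^bsub>tensor T M1 M2\<^esub> = tensor_class T M1 M2 {#}"
  by (simp_all add: tensor_def)

lemma add_tensor_class:
  assumes "p \<in> formal_sums M1 M2" and "q \<in> formal_sums M1 M2"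
  shows "tensor_class T M1 M2 p \<oplus>\<^bsub>tensor T M1 M2\<^esub> tensor_class T M1 M2 q = tensor_class T M1 M2 (p + q)"
proof -
  have "(\<Union>q'\<in>tensor_class T M1 M2 q. tensor_class T M1 M2 (p' + q')) = tensor_class T M1 M2 (p' + q)"
    if "tensor_cong T M1 M2 p p'" for p'
  proof (rule tensor_class_Union[OF assms(2)])
    fix q' assume "tensor_cong T M1 M2 q q'"
    \<comment> \<open>Closure of the carriers under the operations is not assumed here, so
      reflexivity at \<open>p'\<close> is obtained by going to \<open>p\<close> and back rather than
      from membership in \<open>formal_sums\<close>.\<close>
    moreover have "tensor_cong T M1 M2 p' p'"
      using that tensor_cong.sym tensor_cong.trans by blast
    ultimately show "tensor_cong T M1 M2 (p' + q) (p' + q')"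
      by (blast intro: tensor_cong.add)
  qed
  then have "(\<Union>p'\<in>tensor_class T M1 M2 p. \<Union>q'\<in>tensor_class T M1 M2 q. tensor_class T M1 M2 (p' + q'))
    = (\<Union>p'\<in>tensor_class T M1 M2 p. tensor_class T M1 M2 (p' + q))"
    by (simp add: tensor_class_def)
  also have "\<dots> = tensor_class T M1 M2 (p + q)"
  proof (rule tensor_class_Union[OF assms(1)])
    fix p' assume "tensor_cong T M1 M2 p p'"
    then show "tensor_cong T M1 M2 (p + q) (p' + q)"
      using assms(2) by (blast intro: tensor_cong.add tensor_cong.refl)
  qed
  finally show ?thesis
    by (simp add: tensor_def)
qed

text \<open>The pair of maps is the action of \<open>a\<close> and the identity. Left action by
  \<open>a\<close> respects the balancing relation because it commutes with the right action of
  \<open>T\<close>, by \<open>M1.act_assoc\<close>.\<close>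

lemma lact_tensor_class:
  assumes "bimodule A T M1" and "bimodule T B M2"
    and "a \<in> carrier A" and "p \<in> formal_sums M1 M2"
  shows "a \<triangleright>\<^bsub>tensor T M1 M2\<^esub> tensor_class T M1 M2 p
    = tensor_class T M1 M2 {#(a \<triangleright>\<^bsub>M1\<^esub> v, w). (v, w) \<in># p#}"
proof -
  interpret M1: bimodule A T M1 by fact
  interpret M2: bimodule T B M2 by fact
  have "tensor_cong T M1 M2 {#(a \<triangleright>\<^bsub>M1\<^esub> v, w). (v, w) \<in># p#} {#(a \<triangleright>\<^bsub>M1\<^esub> v, w). (v, w) \<in># q#}"
    if "tensor_cong T M1 M2 p q" for q
    by (rule tensor_cong_image[where ?g2.0 = "\<lambda>w. w", OF _ _ _ _ _ _ _ _ that])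
      (use assms(3) in \<open>auto simp: M1.lact_closed M1.lact_zero M1.lact_add M1.act_assoc\<close>)
  from tensor_class_Union[where h = "image_mset (\<lambda>(v, w). (a \<triangleright>\<^bsub>M1\<^esub> v, w))", OF assms(4) this]
  show ?thesis
    by (simp add: tensor_def)
qed

lemma ract_tensor_class:
  assumes "bimodule A T M1" and "bimodule T B M2"
    and "b \<in> carrier B" and "p \<in> formal_sums M1 M2"
  shows "tensor_class T M1 M2 p \<triangleleft>\<^bsub>tensor T M1 M2\<^esub> b
    = tensor_class T M1 M2 {#(v, w \<triangleleft>\<^bsub>M2\<^esub> b). (v, w) \<in># p#}"
proof -
  interpret M1: bimodule A T M1 by fact
  interpret M2: bimodule T B M2 by fact
  have "tensor_cong T M1 M2 {#(v, w \<triangleleft>\<^bsub>M2\<^esub> b). (v, w) \<in># p#} {#(v, w \<triangleleft>\<^bsub>M2\<^esub> b). (v, w) \<in># q#}"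
    if "tensor_cong T M1 M2 p q" for q
    by (rule tensor_cong_image[where ?g1.0 = "\<lambda>v. v", OF _ _ _ _ _ _ _ _ that])
      (use assms(3) in \<open>auto simp: M2.ract_closed M2.ract_zero M2.ract_add M2.act_assoc\<close>)
  from tensor_class_Union[where h = "image_mset (\<lambda>(v, w). (v, w \<triangleleft>\<^bsub>M2\<^esub> b))", OF assms(4) this]
  show ?thesis
    by (simp add: tensor_def)
qed

text \<open>The module laws hold only on the carriers; since the entries of a formal sum lie there,
  entrywise maps need to be compared only there.\<close>

lemma image_formal_sums_cong:
  assumes "p \<in> formal_sums M1 M2"
    and "\<And>v w. \<lbrakk>v \<in> carrier M1; w \<in> carrier M2\<rbrakk> \<Longrightarrow> h (v, w) = h' (v, w)"
  shows "image_mset h p = image_mset h' p"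
  using assms by (intro image_mset_cong) (auto simp: formal_sums_def)

lemma image_formal_sums_id:
  assumes "p \<in> formal_sums M1 M2"
    and "\<And>v w. \<lbrakk>v \<in> carrier M1; w \<in> carrier M2\<rbrakk> \<Longrightarrow> h (v, w) = (v, w)"
  shows "image_mset h p = p"
  using image_formal_sums_cong[OF assms(1), of h "\<lambda>x. x"] assms(2) by simp

lemma bimodule_tensor:
  assumes "bimodule A T M1" and "bimodule T B M2"
  shows "bimodule A B (tensor T M1 M2)"
proof -
  interpret M1: bimodule A T M1 by fact
  interpret M2: bimodule T B M2 by fact
  let ?M = "tensor T M1 M2"
  \<comment> \<open>The unit, associativity and interchange laws hold already between formal sums,
    entry by entry. The interchange law is immediate, since the two outer actions touch different
    coordinates.\<close>
  have acts:
    "{#(\<one>\<^bsub>A\<^esub> \<triangleright>\<^bsub>M1\<^esub> v, w). (v, w) \<in># p#} = p"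
    "{#(v, w \<triangleleft>\<^bsub>M2\<^esub> \<one>\<^bsub>B\<^esub>). (v, w) \<in># p#} = p"
    "\<lbrakk>a \<in> carrier A; a' \<in> carrier A\<rbrakk> \<Longrightarrow> {#(a \<triangleright>\<^bsub>M1\<^esub> v, w). (v, w) \<in># {#(a' \<triangleright>\<^bsub>M1\<^esub> v, w). (v, w) \<in># p#}#}
      = {#((a \<otimes>\<^bsub>A\<^esub> a') \<triangleright>\<^bsub>M1\<^esub> v, w). (v, w) \<in># p#}"
    "\<lbrakk>b \<in> carrier B; b' \<in> carrier B\<rbrakk> \<Longrightarrow> {#(v, w \<triangleleft>\<^bsub>M2\<^esub> b'). (v, w) \<in># {#(v, w \<triangleleft>\<^bsub>M2\<^esub> b). (v, w) \<in># p#}#}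
      = {#(v, w \<triangleleft>\<^bsub>M2\<^esub> (b \<otimes>\<^bsub>B\<^esub> b')). (v, w) \<in># p#}"
    "{#(v, w \<triangleleft>\<^bsub>M2\<^esub> b). (v, w) \<in># {#(a \<triangleright>\<^bsub>M1\<^esub> v, w). (v, w) \<in># p#}#}
      = {#(a \<triangleright>\<^bsub>M1\<^esub> v, w). (v, w) \<in># {#(v, w \<triangleleft>\<^bsub>M2\<^esub> b). (v, w) \<in># p#}#}"
    if "p \<in> formal_sums M1 M2" for p a a' b b'
    unfolding image_mset.compositionality using that
    by (auto intro!: image_formal_sums_id image_formal_sums_cong
        simp: M1.lact_one M2.ract_one M1.lact_assoc M2.ract_assoc)
  note ops = carrier_tensor zero_tensor add_tensor_class lact_tensor_class[OF assms]
    ract_tensor_class[OF assms] formal_sums_empty formal_sums_add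
    M1.lact_formal_sums M2.ract_formal_sums
  \<comment> \<open>The additive laws descend from multiset union. The distributive and zero laws of
    the actions follow afterwards from the additivity of \<open>image_mset\<close>.\<close>
  have "abelian_monoid ?M"
    by (intro abelian_monoidI) (auto simp: ops ac_simps)
  moreover have "bimodule_axioms A B ?M"
    by unfold_locales (auto simp: ops acts)
  ultimately show ?thesis
    using M1.A.monoid_axioms M2.B.monoid_axioms by (simp add: bimodule_def)
qed

text \<open>As for the operations of \<open>tensor\<close>, the union avoids choosing a
  representative. The source modules enter only through the class \<open>X\<close>.\<close>

definition tensor_map ::
  "('t, 'r) monoid_scheme \<Rightarrow> ('a, 'n1, 't, 'y) bimodule_scheme \<Rightarrow> ('t, 'n2, 'b, 'z) bimodule_scheme
    \<Rightarrow> ('m1 \<Rightarrow> 'n1) \<Rightarrow> ('m2 \<Rightarrow> 'n2) \<Rightarrow> ('m1 \<times> 'm2) multiset set \<Rightarrow> ('n1 \<times> 'n2) multiset set"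
  where "tensor_map T N1 N2 f1 f2 X = (\<Union>p\<in>X. tensor_class T N1 N2 {#(f1 v, f2 w). (v, w) \<in># p#})"

text \<open>This is the well-definedness of \<open>f1 \<otimes> f2\<close>: compatibility of
  \<open>f1\<close> with the right and of \<open>f2\<close> with the left action of \<open>T\<close>
  preserves the balancing relation.\<close>

lemma tensor_map_class:
  assumes "bimodule_hom A T M1 N1 f1" and "bimodule_hom T B M2 N2 f2" and "p \<in> formal_sums M1 M2"
  shows "tensor_map T N1 N2 f1 f2 (tensor_class T M1 M2 p)
    = tensor_class T N1 N2 {#(f1 v, f2 w). (v, w) \<in># p#}"
proof -
  interpret f1: bimodule_hom A T M1 N1 f1 by fact
  interpret f2: bimodule_hom T B M2 N2 f2 by fact
  have "tensor_cong T N1 N2 {#(f1 v, f2 w). (v, w) \<in># p#} {#(f1 v, f2 w). (v, w) \<in># q#}"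
    if "tensor_cong T M1 M2 p q" for q
    by (rule tensor_cong_image[OF _ _ _ _ _ _ _ _ that])
      (simp_all add: f1.hom_closed f1.hom_zero f1.hom_add f1.hom_ract
        f2.hom_closed f2.hom_zero f2.hom_add f2.hom_lact)
  from tensor_class_Union[where h = "image_mset (\<lambda>(v, w). (f1 v, f2 w))", OF assms(3) this]
  show ?thesis
    unfolding tensor_map_def .
qed

lemma bimodule_hom_tensor_map:
  assumes "bimodule_hom A T M1 N1 f1" and "bimodule_hom T B M2 N2 f2"
  shows "bimodule_hom A B (tensor T M1 M2) (tensor T N1 N2) (tensor_map T N1 N2 f1 f2)"
proof -
  interpret f1: bimodule_hom A T M1 N1 f1 by fact
  interpret f2: bimodule_hom T B M2 N2 f2 by fact
  note M = f1.M.bimodule_axioms f2.M.bimodule_axioms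
  note N = f1.N.bimodule_axioms f2.N.bimodule_axioms
  interpret M: bimodule A B "tensor T M1 M2" by (rule bimodule_tensor[OF M])
  interpret N: bimodule A B "tensor T N1 N2" by (rule bimodule_tensor[OF N])
  \<comment> \<open>The outer left action passes through \<open>f1\<close> and the outer right
    action through \<open>f2\<close>, again entry by entry before taking classes.\<close>
  have acts:
    "a \<in> carrier A \<Longrightarrow> {#(f1 v, f2 w). (v, w) \<in># {#(a \<triangleright>\<^bsub>M1\<^esub> v, w). (v, w) \<in># p#}#}
      = {#(a \<triangleright>\<^bsub>N1\<^esub> v, w). (v, w) \<in># {#(f1 v, f2 w). (v, w) \<in># p#}#}"
    "b \<in> carrier B \<Longrightarrow> {#(f1 v, f2 w). (v, w) \<in># {#(v, w \<triangleleft>\<^bsub>M2\<^esub> b). (v, w) \<in># p#}#}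
      = {#(v, w \<triangleleft>\<^bsub>N2\<^esub> b). (v, w) \<in># {#(f1 v, f2 w). (v, w) \<in># p#}#}"
    if "p \<in> formal_sums M1 M2" for p a b
    unfolding image_mset.compositionality using that
    by (auto intro!: image_formal_sums_cong simp: f1.hom_lact f2.hom_ract)
  note ops = carrier_tensor zero_tensor add_tensor_class lact_tensor_class[OF M] lact_tensor_class[OF N]
    ract_tensor_class[OF M] ract_tensor_class[OF N] formal_sums_empty formal_sums_add
    f1.M.lact_formal_sums f2.M.ract_formal_sums
    tensor_map_class[OF assms] image_formal_sums[OF f1.hom_closed f2.hom_closed]
  show ?thesis
    by unfold_locales (auto simp: ops acts)
qed

text \<open>Elements of \<open>tensor_null\<close> are finite sums of simple tensors, so this
  reduces the claim on null parts to single simple tensors.\<close>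

lemma (in bimodule_hom) hom_finsum:
  assumes "finite I" and "g \<in> I \<rightarrow> carrier M"
  shows "f (\<Oplus>\<^bsub>M\<^esub>i\<in>I. g i) = (\<Oplus>\<^bsub>N\<^esub>i\<in>I. f (g i))"
  using assms hom_closed
  by (induction I rule: finite_induct)
    (auto simp: hom_zero hom_add Pi_iff)

text \<open>A bimodule homomorphism need not respect null parts, so the claim about them carries the
  proviso that \<open>f1\<close> and \<open>f2\<close> do. Otherwise identity maps, with
  \<open>M10\<close> the whole of \<open>M1\<close> and with \<open>N10\<close> and
  \<open>N20\<close> zero, would violate it whenever the tensor product is nonzero.\<close>

theorem theorem4p10:
  fixes T1 :: "('a, 'r1) monoid_scheme"
    and T :: "('t, 'r) monoid_scheme"
    and T2 :: "('b, 'r2) monoid_scheme"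
    and M1 :: "('a, 'm1, 't, 'x1) bimodule_scheme"
    and N1 :: "('a, 'n1, 't, 'y1) bimodule_scheme"
    and M2 :: "('t, 'm2, 'b, 'x2) bimodule_scheme"
    and N2 :: "('t, 'n2, 'b, 'y2) bimodule_scheme"
    and M10 :: "'m1 set" and N10 :: "'n1 set" and M20 :: "'m2 set" and N20 :: "'n2 set"
    and f1 :: "'m1 \<Rightarrow> 'n1" and f2 :: "'m2 \<Rightarrow> 'n2"
  assumes "monoid T1" and "monoid T" and "monoid T2"
    and "bimodule_prepair T1 T M1 M10" and "bimodule_prepair T1 T N1 N10"
    and "bimodule_prepair T T2 M2 M20" and "bimodule_prepair T T2 N2 N20"
    and "bimodule_hom T1 T M1 N1 f1"
    and "bimodule_hom T T2 M2 N2 f2"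
  shows "\<exists>F. bimodule_hom T1 T2 (tensor T M1 M2) (tensor T N1 N2) F \<and>
    (\<forall>v1\<in>carrier M1. \<forall>v2\<in>carrier M2.
      F (simple_tensor T M1 M2 v1 v2) = simple_tensor T N1 N2 (f1 v1) (f2 v2)) \<and>
    (f1 ` M10 \<subseteq> N10 \<and> f2 ` M20 \<subseteq> N20 \<longrightarrow>
      F ` tensor_null T M1 M10 M2 M20 \<subseteq> tensor_null T N1 N10 N2 N20)"
proof -
  interpret f1: bimodule_hom T1 T M1 N1 f1 by fact
  interpret f2: bimodule_hom T T2 M2 N2 f2 by fact
  let ?F = "tensor_map T N1 N2 f1 f2"
  interpret F: bimodule_hom T1 T2 "tensor T M1 M2" "tensor T N1 N2" ?F
    by (rule bimodule_hom_tensor_map) fact+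
  have F_simple: "?F (simple_tensor T M1 M2 v w) = simple_tensor T N1 N2 (f1 v) (f2 w)"
    if "v \<in> carrier M1" "w \<in> carrier M2" for v w
    using that tensor_map_class[OF assms(8,9), of "{#(v, w)#}"]
    by (simp add: simple_tensor_def formal_sums_def)
  have "?F X \<in> tensor_null T N1 N10 N2 N20"
    if null: "f1 ` M10 \<subseteq> N10" "f2 ` M20 \<subseteq> N20" and X: "X \<in> tensor_null T M1 M10 M2 M20" for X
  proof -
    obtain k :: nat and v w
      where X_eq: "X = (\<Oplus>\<^bsub>tensor T M1 M2\<^esub>i\<in>{..<k}. simple_tensor T M1 M2 (v i) (w i))"
        and vw: "\<forall>i<k. v i \<in> carrier M1 \<and> w i \<in> carrier M2 \<and> (v i \<in> M10 \<or> w i \<in> M20)"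
      using X unfolding tensor_null_def by blast
    have "simple_tensor T M1 M2 (v i) (w i) \<in> carrier (tensor T M1 M2)" if "i < k" for i
      using vw that by (auto simp: simple_tensor_def carrier_tensor formal_sums_def)
    then have "?F X = (\<Oplus>\<^bsub>tensor T N1 N2\<^esub>i\<in>{..<k}. ?F (simple_tensor T M1 M2 (v i) (w i)))"
      unfolding X_eq by (intro F.hom_finsum) auto
    also have "\<dots> = (\<Oplus>\<^bsub>tensor T N1 N2\<^esub>i\<in>{..<k}. simple_tensor T N1 N2 (f1 (v i)) (f2 (w i)))"
    proof (rule F.N.M.finsum_cong')
      show "(\<lambda>i. simple_tensor T N1 N2 (f1 (v i)) (f2 (w i))) \<in> {..<k} \<rightarrow> carrier (tensor T N1 N2)"
        using vw f1.hom_closed f2.hom_closed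
        by (auto simp: simple_tensor_def carrier_tensor formal_sums_def Pi_iff)
    qed (use vw F_simple in auto)
    also have "\<dots> \<in> tensor_null T N1 N10 N2 N20"
      unfolding tensor_null_def mem_Collect_eq
      \<comment> \<open>The sum keeps its length \<open>k\<close>, and in each term the factor lying
        in \<open>M10\<close> or \<open>M20\<close> is sent into \<open>N10\<close> or
        \<open>N20\<close> respectively.\<close>
      by (rule exI[of _ k], rule exI[of _ "\<lambda>i. f1 (v i)"], rule exI[of _ "\<lambda>i. f2 (w i)"])
        (use vw null f1.hom_closed f2.hom_closed in \<open>auto simp: Pi_iff image_subset_iff\<close>)
    finally show ?thesis .
  qed
  then show ?thesis
    by (intro exI[of _ ?F] conjI F.bimodule_hom_axioms) (auto simp: F_simple)
qed

end
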